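(* Let $S$ be a finite set of points in $\mathbb{R}^3$. Then the diameter graph on $S$ has a bipartite double covering that has a centrally symmetric drawing, with no crossing edges, on the $2$-sphere $\mathbb{S}^2$.
   Context: For a finite set $S$ of points in $\mathbb{R}^d$ (with the Euclidean norm), the diameter $D$ of $S$ is the maximum distance between two points of $S$. The diameter graph on $S$ is the graph with vertex set $S$ in which two distinct points are joined by an edge exactly when they are at distance $D$; such a pair $xy$ is called a diameter. The sphere $\mathbb{S}^2$ is the unit sphere in $\mathbb{R}^3$ centred at the origin. The bipartite double covering has two vertices $x_r$ (coloured red) and $x_b$ (coloured blue) for each $x\in S$, and two edges $x_ry_b$ and $x_by_r$ for each edge $xy$ of the diameter graph (and no other edges). A centrally symmetric drawing of it on $\mathbb{S}^2$ represents the vertices by distinct points of $\mathbb{S}^2$ and the edges by simple arcs on $\mathbb{S}^2$ joining their endpoints, such that $x_b=-x_r$ for each $x\in S$ and, for each edge $xy$ of the diameter graph, the arcs representing $x_ry_b$ and $x_by_r$ are antipodal (each is the image of the other under $p\mapsto -p$). No edges cross means that two distinct arcs meet only in common endpoints, and an arc contains no vertex other than its endpoints. *)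

theory Defs
  imports "HOL-Analysis.Analysis"
begin

text \<open>
  Graphs are given by a vertex set and a set of edges, an edge being the unordered pair
  (two-element set) of its endpoints.
\<close>

definition diameter_edges :: "'a::metric_space set \<Rightarrow> 'a set set" where
  "diameter_edges S = {{x, y} | x y. x \<in> S \<and> y \<in> S \<and> x \<noteq> y \<and> dist x y = diameter S}"

text \<open>
  The library's \<open>diameter\<close> is a supremum; for finite nonempty sets it is the maximum distance.
\<close>

lemma diameter_eq_Max:
  fixes S :: "'a::metric_space set"
  assumes "finite S" "S \<noteq> {}"
  shows "diameter S = Max {dist x y | x y. x \<in> S \<and> y \<in> S}"
proof -
  have eq: "{dist x y | x y. x \<in> S \<and> y \<in> S} = (\<lambda>(x, y). dist x y) ` (S \<times> S)"
    by auto
  show ?thesis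
    unfolding eq diameter_def using assms by (simp add: cSup_eq_Max)
qed

datatype colour = Red | Blue

definition double_cover_verts :: "'a set \<Rightarrow> ('a \<times> colour) set" where
  "double_cover_verts V = V \<times> UNIV"

text \<open>
  Since \<open>{x, y} = {y, x}\<close>, each edge contributes both \<open>{(x, Red), (y, Blue)}\<close> and
  \<open>{(y, Red), (x, Blue)}\<close>.
\<close>

definition double_cover_edges :: "'a set set \<Rightarrow> ('a \<times> colour) set set" where
  "double_cover_edges E = {{(x, Red), (y, Blue)} | x y. {x, y} \<in> E}"

definition is_simple_arc :: "(real^3) set \<Rightarrow> real^3 \<Rightarrow> real^3 \<Rightarrow> bool" where
  "is_simple_arc A p q \<longleftrightarrow>
     (\<exists>g. arc g \<and> path_image g = A \<and> pathstart g = p \<and> pathfinish g = q)"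

text \<open>
  A drawing consists of a point \<open>pt v\<close> for each vertex and a point set \<open>ar e\<close>,
  the image of a simple arc, for each edge.
\<close>

definition sphere_drawing ::
  "'v set \<Rightarrow> 'v set set \<Rightarrow> ('v \<Rightarrow> real^3) \<Rightarrow> ('v set \<Rightarrow> (real^3) set) \<Rightarrow> bool" where
  "sphere_drawing V E pt ar \<longleftrightarrow>
     inj_on pt V \<and> pt ` V \<subseteq> sphere 0 1 \<and>
     (\<forall>u v. {u, v} \<in> E \<longrightarrow>
        is_simple_arc (ar {u, v}) (pt u) (pt v) \<and> ar {u, v} \<subseteq> sphere 0 1)"

definition no_crossings ::
  "'v set \<Rightarrow> 'v set set \<Rightarrow> ('v \<Rightarrow> real^3) \<Rightarrow> ('v set \<Rightarrow> (real^3) set) \<Rightarrow> bool" where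
  "no_crossings V E pt ar \<longleftrightarrow>
     (\<forall>e\<in>E. \<forall>f\<in>E. e \<noteq> f \<longrightarrow> ar e \<inter> ar f \<subseteq> pt ` e \<inter> pt ` f) \<and>
     (\<forall>e\<in>E. ar e \<inter> pt ` V \<subseteq> pt ` e)"

text \<open>Here \<open>V\<close> and \<open>E\<close> belong to the base graph, \<open>pt\<close> and \<open>ar\<close> to its double covering.\<close>

definition centrally_symmetric ::
  "'a set \<Rightarrow> 'a set set \<Rightarrow> ('a \<times> colour \<Rightarrow> real^3) \<Rightarrow> (('a \<times> colour) set \<Rightarrow> (real^3) set) \<Rightarrow> bool"
  where
  "centrally_symmetric V E pt ar \<longleftrightarrow>
     (\<forall>x\<in>V. pt (x, Blue) = - pt (x, Red)) \<and>
     (\<forall>x y. {x, y} \<in> E \<longrightarrow> ar {(x, Blue), (y, Red)} = uminus ` ar {(x, Red), (y, Blue)})"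

end

theory Submission
  imports Defs
begin

text \<open>
  For a point \<open>x\<close> of \<open>S\<close>, look at the directions \<open>y - x\<close> of the diameters \<open>xy\<close> at \<open>x\<close>, and let
  \<open>C x\<close> be the cone that they span.  The drawing comes from how these cones lie in space.  Cones of
  different points meet only in \<open>0\<close>: every \<open>u\<close> in \<open>C x\<close> has an acute angle with \<open>z - x\<close>, and every
  element of \<open>C z\<close> has an obtuse one (\<open>cones_disjoint\<close>).  The cones \<open>C x\<close> and \<open>- C w\<close> meet outside \<open>0\<close>
  only if \<open>xw\<close> is a diameter, and then exactly in the ray of \<open>w - x\<close> (\<open>cones_opposite\<close>).
  So on the sphere the regions of the \<open>C x\<close> (red) and of the \<open>- C x\<close> (blue) form a contact
  representation of the double covering, and it is invariant under \<open>q \<mapsto> - q\<close>.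

  If every point has at least two diameters, every direction spans an exposed ray of its cone
  (\<open>dir_exposed\<close>).  Put \<open>x\<^sub>r\<close> at the barycentre of the red region of \<open>x\<close>, put \<open>x\<^sub>b\<close> at the antipode,
  and draw the edge \<open>x\<^sub>ry\<^sub>b\<close> as a great-circle arc from \<open>x\<^sub>r\<close> to the contact point \<open>y - x\<close>, followed by a
  great-circle arc from there to \<open>y\<^sub>b\<close>.  Exposedness keeps the arcs that leave \<open>x\<^sub>r\<close> apart, and the
  statements about cones exclude all other crossings.

  A point with at most one diameter is removed first and put back into the drawing of the
  remaining points.  Since the whole drawing lies on finitely many great circles, a generic short
  arc starting at a vertex leaves the drawing at once and never returns (\<open>ex_generic_spur\<close>); such
  an arc and its antipode carry the new leaf.  Removing a point may lower the diameter, so the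
  induction is over graphs of a fixed distance \<open>D\<close> that no distance exceeds.
\<close>

section \<open>Great-circle arcs\<close>

text \<open>
  An arc is defined as the section of a cone with the sphere, so that intersections of arcs can be
  determined by comparing coefficients of linear combinations.
\<close>

definition great_arc :: "real^3 \<Rightarrow> real^3 \<Rightarrow> (real^3) set" where
  "great_arc a b = {q. norm q = 1 \<and> (\<exists>s\<ge>0. \<exists>t\<ge>0. q = s *\<^sub>R a + t *\<^sub>R b)}"

lemma great_arcE:
  assumes "q \<in> great_arc a b"
  obtains s t where "s \<ge> 0" "t \<ge> 0" "q = s *\<^sub>R a + t *\<^sub>R b" "norm q = 1"
  using assms unfolding great_arc_def by blast

lemma great_arc_subset_sphere: "great_arc a b \<subseteq> sphere 0 1"
  by (auto simp: great_arc_def)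

text \<open>
  The arc is the radial projection of the segment from \<open>a\<close> to \<open>b\<close>, which by independence avoids
  the origin and meets every ray from it at most once.
\<close>

lemma simple_arc_great_arc:
  assumes indep: "\<And>s t. s *\<^sub>R a + t *\<^sub>R b = 0 \<Longrightarrow> s = 0 \<and> t = 0"
  shows "is_simple_arc (great_arc a b) (sgn a) (sgn b)"
proof -
  define g where "g = (\<lambda>t. sgn (linepath a b t))"
  have nz: "linepath a b t \<noteq> 0" for t
    using indep[of "1 - t" t] by (auto simp: linepath_def)
  have "path g"
    unfolding path_def g_def
    by (intro continuous_on_sgn continuous_on_linepath) (simp add: nz)
  moreover have "inj_on g {0..1}"
  proof (rule inj_onI)
    fix s t :: real
    assume "g s = g t"
    define v w where "v = inverse (norm (linepath a b s))" and "w = inverse (norm (linepath a b t))"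
    have "v > 0"
      by (simp add: v_def nz)
    have "v *\<^sub>R linepath a b s = w *\<^sub>R linepath a b t"
      using \<open>g s = g t\<close> by (simp add: g_def sgn_div_norm v_def w_def)
    then have "(v * (1 - s) - w * (1 - t)) *\<^sub>R a + (v * s - w * t) *\<^sub>R b = 0"
      by (simp add: linepath_def algebra_simps)
    then have "v * (1 - s) - w * (1 - t) = 0 \<and> v * s - w * t = 0"
      by (rule indep)
    then have "v = w" "v * s = w * t"
      by (simp_all add: algebra_simps)
    then show "s = t"
      using \<open>v > 0\<close> by simp
  qed
  moreover have "path_image g = great_arc a b"
  proof (intro equalityI subsetI)
    fix q assume "q \<in> path_image g"
    then obtain t where t: "0 \<le> t" "t \<le> 1" "q = sgn (linepath a b t)"
      by (auto simp: path_image_def g_def)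
    let ?k = "inverse (norm (linepath a b t))"
    have "q = (?k * (1 - t)) *\<^sub>R a + (?k * t) *\<^sub>R b"
      using t(3) by (simp add: sgn_div_norm linepath_def scaleR_add_right)
    moreover have "?k * (1 - t) \<ge> 0" "?k * t \<ge> 0"
      using t by simp_all
    moreover have "norm q = 1"
      using t nz by (simp add: norm_sgn)
    ultimately show "q \<in> great_arc a b"
      unfolding great_arc_def by blast
  next
    fix q assume "q \<in> great_arc a b"
    then obtain s t where st: "s \<ge> 0" "t \<ge> 0" "q = s *\<^sub>R a + t *\<^sub>R b" "norm q = 1"
      by (rule great_arcE)
    then have pos: "s + t > 0"
      by (cases "s = 0 \<and> t = 0") auto
    have "(s + t) * (1 - t / (s + t)) = s" "(s + t) * (t / (s + t)) = t"
      using pos by (simp_all add: field_simps)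
    then have "q = (s + t) *\<^sub>R linepath a b (t / (s + t))"
      unfolding st(3) linepath_def scaleR_add_right scaleR_scaleR by simp
    then have "sgn q = sgn (linepath a b (t / (s + t)))"
      using pos by (simp add: sgn_scaleR)
    then have "q = g (t / (s + t))"
      using st(4) by (simp add: g_def sgn_div_norm)
    moreover have "t / (s + t) \<in> {0..1}"
      using st pos by (auto simp: field_simps)
    ultimately show "q \<in> path_image g"
      unfolding path_image_def by blast
  qed
  moreover have "pathstart g = sgn a" "pathfinish g = sgn b"
    by (simp_all add: g_def pathstart_def pathfinish_def linepath_def)
  ultimately show ?thesis
    unfolding is_simple_arc_def arc_def by blast
qed

lemma unit_neq_uminus:
  fixes v :: "'a::real_normed_vector"
  assumes "norm v = 1"
  shows "v \<noteq> - v"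
proof
  assume "v = - v"
  then have "2 *\<^sub>R v = 0"
    by (metis add.right_inverse scaleR_2)
  then show False
    using assms by simp
qed

lemma ex_common_normal: "\<exists>n::real^3. n \<noteq> 0 \<and> n \<bullet> a = 0 \<and> n \<bullet> b = 0"
proof -
  have "dim {a, b} \<le> card {a, b}"
    by (rule dim_le_card') simp
  also have "\<dots> \<le> 2"
    by (simp add: card_insert_if)
  finally have "dim {a, b} < DIM(real^3)"
    by simp
  then obtain n where "n \<noteq> 0" "\<And>y. y \<in> span {a, b} \<Longrightarrow> orthogonal n y"
    by (rule orthogonal_to_subspace_exists) blast
  then show ?thesis
    unfolding orthogonal_def by (meson insertCI span_base)
qed

lemma great_arc_normal:
  assumes "q \<in> great_arc a b" "n \<bullet> a = 0" "n \<bullet> b = 0"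
  shows "n \<bullet> q = 0"
  using assms by (auto simp: great_arc_def inner_add_right)

lemma is_simple_arc_reverse: "is_simple_arc A p q \<Longrightarrow> is_simple_arc A q p"
  unfolding is_simple_arc_def
  by (metis arc_reversepath path_image_reversepath pathfinish_reversepath pathstart_reversepath)

lemma is_simple_arc_uminus:
  assumes "is_simple_arc A p q"
  shows "is_simple_arc (uminus ` A) (- p) (- q)"
proof -
  obtain g where g: "arc g" "path_image g = A" "pathstart g = p" "pathfinish g = q"
    using assms by (auto simp: is_simple_arc_def)
  have "arc (uminus \<circ> g)"
    using g(1) by (auto simp: arc_def path_def inj_on_def intro!: continuous_intros)
  then show ?thesis
    unfolding is_simple_arc_def using g
    by (intro exI[of _ "uminus \<circ> g"])
       (auto simp: path_image_compose pathstart_compose pathfinish_compose)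
qed

lemma is_simple_arc_join:
  assumes "is_simple_arc A p q" "is_simple_arc B q r" "A \<inter> B \<subseteq> {q}"
  shows "is_simple_arc (A \<union> B) p r"
proof -
  obtain g h where gh: "arc g" "path_image g = A" "pathstart g = p" "pathfinish g = q"
     "arc h" "path_image h = B" "pathstart h = q" "pathfinish h = r"
    using assms by (auto simp: is_simple_arc_def)
  then show ?thesis
    unfolding is_simple_arc_def using assms(3)
    by (intro exI[of _ "g +++ h"]) (auto simp: arc_join path_image_join)
qed

lemma is_simple_arc_ends:
  assumes "is_simple_arc A p q"
  shows "p \<in> A" "q \<in> A" "p \<noteq> q"
  using assms unfolding is_simple_arc_def
  by (metis pathstart_in_path_image pathfinish_in_path_image arc_distinct_ends)+

section \<open>Antipodal drawings and how to extend them\<close>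

text \<open>
  A centrally symmetric drawing is determined by the red points \<open>P x\<close> and by one arc \<open>A x y\<close> from
  \<open>P x\<close> to \<open>- P y\<close> for each ordered pair of adjacent vertices.  The set \<open>N\<close> consists of normal vectors
  of great circles which together contain the drawing.  It is there to make extension possible: its
  finiteness guarantees free room at every vertex, which arbitrary simple arcs need not leave
  in any form that is easy to use.
\<close>

locale antipodal_drawing =
  fixes V :: "'a set" and adj :: "'a \<Rightarrow> 'a \<Rightarrow> bool"
    and P :: "'a \<Rightarrow> real^3" and A :: "'a \<Rightarrow> 'a \<Rightarrow> (real^3) set" and N :: "(real^3) set"
  assumes adj_sym: "adj x y \<Longrightarrow> adj y x"
    and adj_irrefl: "\<not> adj x x"
    and norm_P: "x \<in> V \<Longrightarrow> norm (P x) = 1"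
    and P_inj: "x \<in> V \<Longrightarrow> y \<in> V \<Longrightarrow> P x = P y \<Longrightarrow> x = y"
    and P_neq: "x \<in> V \<Longrightarrow> y \<in> V \<Longrightarrow> P x \<noteq> - P y"
    and arc_A: "x \<in> V \<Longrightarrow> y \<in> V \<Longrightarrow> adj x y \<Longrightarrow> is_simple_arc (A x y) (P x) (- P y)"
    and A_sphere: "x \<in> V \<Longrightarrow> y \<in> V \<Longrightarrow> adj x y \<Longrightarrow> A x y \<subseteq> sphere 0 1"
    and A_antipodal: "x \<in> V \<Longrightarrow> y \<in> V \<Longrightarrow> adj x y \<Longrightarrow> A y x = uminus ` A x y"
    and A_cross: "x \<in> V \<Longrightarrow> y \<in> V \<Longrightarrow> z \<in> V \<Longrightarrow> w \<in> V \<Longrightarrow> adj x y \<Longrightarrow> adj z w \<Longrightarrow>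
      (x, y) \<noteq> (z, w) \<Longrightarrow> q \<in> A x y \<Longrightarrow> q \<in> A z w \<Longrightarrow> x = z \<and> q = P x \<or> y = w \<and> q = - P y"
    and A_vertex: "x \<in> V \<Longrightarrow> y \<in> V \<Longrightarrow> z \<in> V \<Longrightarrow> adj x y \<Longrightarrow> P z \<in> A x y \<Longrightarrow> z = x"
    and finite_N: "finite N"
    and N_nonzero: "0 \<notin> N"
    and P_circle: "x \<in> V \<Longrightarrow> \<exists>n\<in>N. n \<bullet> P x = 0"
    and A_circle: "x \<in> V \<Longrightarrow> y \<in> V \<Longrightarrow> adj x y \<Longrightarrow> q \<in> A x y \<Longrightarrow> \<exists>n\<in>N. n \<bullet> q = 0"
begin

lemma A_antipodal_iff:
  assumes "x \<in> V" "y \<in> V" "adj x y"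
  shows "q \<in> A y x \<longleftrightarrow> - q \<in> A x y"
  using A_antipodal[OF assms] by force

lemma A_vertex_blue:
  assumes "x \<in> V" "y \<in> V" "z \<in> V" "adj x y" "- P z \<in> A x y"
  shows "z = y"
  using A_antipodal_iff[of x y "P z"] A_vertex[of y x z] assms adj_sym by blast

end

text \<open>Finitely many planes through the origin do not cover space.\<close>

lemma ex_generic_vector:
  fixes N :: "(real^3) set"
  assumes "finite N" "0 \<notin> N"
  shows "\<exists>u. \<forall>n\<in>N. n \<bullet> u \<noteq> 0"
proof (rule ccontr)
  assume "\<not> ?thesis"
  then have "(UNIV :: (real^3) set) = (\<Union>n\<in>N. {u. n \<bullet> u = 0})"
    by auto
  moreover have "negligible (\<Union>n\<in>N. {u. n \<bullet> u = 0})"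
    using assms by (intro negligible_Union) (auto intro!: negligible_hyperplane)
  ultimately show False
    using non_negligible_UNIV by metis
qed

text \<open>
  Start at \<open>p\<close> in a direction \<open>u\<close> that lies in none of the given planes.  Planes through \<open>p\<close> are then
  left immediately, and the others have positive distance from \<open>p\<close>, so a short arc \<open>L\<close> meets
  the planes only at \<open>p\<close>.  Staying in the open hemisphere around \<open>p\<close> makes \<open>L\<close> disjoint from its antipode.
  The plane through \<open>p\<close> with normal \<open>n0\<close> ensures that \<open>u\<close> is not a multiple of \<open>p\<close>.
\<close>

lemma ex_generic_spur:
  fixes N :: "(real^3) set"
  assumes "finite N" "0 \<notin> N" "norm p = 1" "n0 \<in> N" "n0 \<bullet> p = 0"
  shows "\<exists>r L m. is_simple_arc L r p \<and> L \<subseteq> sphere 0 1 \<and>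
    (\<forall>q\<in>L. q \<noteq> p \<longrightarrow> (\<forall>n\<in>N. n \<bullet> q \<noteq> 0)) \<and> (\<forall>q\<in>L. q \<bullet> p > 0) \<and>
    m \<noteq> 0 \<and> (\<forall>q\<in>L. m \<bullet> q = 0)"
proof -
  obtain u where u: "\<And>n. n \<in> N \<Longrightarrow> n \<bullet> u \<noteq> 0"
    using ex_generic_vector[OF assms(1,2)] by blast
  have "\<forall>\<^sub>F t in at_right 0. n \<bullet> (p + t *\<^sub>R u) \<noteq> 0" if "n \<in> N" for n
  proof (cases "n \<bullet> p = 0")
    case True
    then show ?thesis
      using u[OF that] by (auto simp: inner_add_right eventually_at_filter)
  next
    case False
    have "((\<lambda>t. n \<bullet> (p + t *\<^sub>R u)) \<longlongrightarrow> n \<bullet> (p + 0 *\<^sub>R u)) (at_right 0)"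
      by (intro tendsto_intros)
    then show ?thesis
      using False by (intro tendsto_imp_eventually_ne) auto
  qed
  then have "\<forall>\<^sub>F t in at_right 0. \<forall>n\<in>N. n \<bullet> (p + t *\<^sub>R u) \<noteq> 0"
    using assms(1) by (simp add: eventually_ball_finite)
  moreover have "\<forall>\<^sub>F t in at_right 0. (p + t *\<^sub>R u) \<bullet> p > 0"
  proof -
    have "((\<lambda>t. (p + t *\<^sub>R u) \<bullet> p) \<longlongrightarrow> (p + 0 *\<^sub>R u) \<bullet> p) (at_right 0)"
      by (intro tendsto_intros)
    moreover have "(p + 0 *\<^sub>R u) \<bullet> p > 0"
      using assms(3) by (auto simp: dot_square_norm)
    ultimately show ?thesis
      by (rule order_tendstoD)
  qed
  ultimately have "\<forall>\<^sub>F t in at_right 0. (\<forall>n\<in>N. n \<bullet> (p + t *\<^sub>R u) \<noteq> 0) \<and> (p + t *\<^sub>R u) \<bullet> p > 0"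
    by (rule eventually_conj)
  then obtain b where b: "b > 0" "\<And>t. 0 < t \<Longrightarrow> t < b \<Longrightarrow> (\<forall>n\<in>N. n \<bullet> (p + t *\<^sub>R u) \<noteq> 0) \<and> (p + t *\<^sub>R u) \<bullet> p > 0"
    unfolding eventually_at_right_field by blast
  define \<tau> where "\<tau> = b / 2"
  have \<tau>: "0 < \<tau>" "\<tau> < b"
    using b(1) by (auto simp: \<tau>_def)
  define L where "L = great_arc (p + \<tau> *\<^sub>R u) p"
  have on_L: "q = p \<or> (\<exists>k>0. \<exists>t. 0 < t \<and> t < b \<and> q = k *\<^sub>R (p + t *\<^sub>R u))"
    if q: "q \<in> L" for q
  proof -
    obtain s t where st: "s \<ge> 0" "t \<ge> 0" "q = s *\<^sub>R (p + \<tau> *\<^sub>R u) + t *\<^sub>R p" "norm q = 1"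
      using q unfolding L_def by (rule great_arcE)
    show ?thesis
    proof (cases "s = 0")
      case True
      then show ?thesis
        using st assms(3) by simp
    next
      case False
      then have "s + t > 0" "s > 0"
        using st by auto
      have "q = (s + t) *\<^sub>R (p + (s * \<tau> / (s + t)) *\<^sub>R u)"
      proof -
        have "(s + t) * (s * \<tau> / (s + t)) = s * \<tau>"
          using \<open>s + t > 0\<close> by simp
        then show ?thesis
          unfolding st(3) scaleR_add_right[of "s + t"] scaleR_scaleR
          by (simp add: algebra_simps)
      qed
      moreover have "0 < s * \<tau> / (s + t)"
        using \<open>s > 0\<close> \<open>s + t > 0\<close> \<tau> by simp
      moreover have "s * \<tau> / (s + t) < b"
      proof -
        have "s * \<tau> \<le> (s + t) * \<tau>"
          using st \<tau> by (simp add: mult_right_mono)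
        also have "\<dots> < (s + t) * b"
          using \<tau> \<open>s + t > 0\<close> by simp
        finally show ?thesis
          using \<open>s + t > 0\<close> by (simp add: field_simps)
      qed
      ultimately show ?thesis
        using \<open>s + t > 0\<close> by blast
    qed
  qed
  have "is_simple_arc L (sgn (p + \<tau> *\<^sub>R u)) (sgn p)"
    unfolding L_def
  proof (rule simple_arc_great_arc)
    fix s t
    assume *: "s *\<^sub>R (p + \<tau> *\<^sub>R u) + t *\<^sub>R p = 0"
    then have "n0 \<bullet> (s *\<^sub>R (p + \<tau> *\<^sub>R u) + t *\<^sub>R p) = 0"
      by simp
    then have "s * \<tau> * (n0 \<bullet> u) = 0"
      using assms(5) by (simp add: inner_add_right)
    then have "s = 0"
      using \<tau> u[OF assms(4)] by simp
    then show "s = 0 \<and> t = 0"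
      using * assms(3) by auto
  qed
  then have "is_simple_arc L (sgn (p + \<tau> *\<^sub>R u)) p"
    using assms(3) by (simp add: sgn_div_norm)
  moreover have "L \<subseteq> sphere 0 1"
    unfolding L_def by (rule great_arc_subset_sphere)
  moreover have "\<forall>q\<in>L. q \<noteq> p \<longrightarrow> (\<forall>n\<in>N. n \<bullet> q \<noteq> 0)"
    using on_L b(2) by fastforce
  moreover have "\<forall>q\<in>L. q \<bullet> p > 0"
    using on_L b(2) assms(3) by (fastforce simp: dot_square_norm)
  moreover obtain m where "m \<noteq> 0" "m \<bullet> (p + \<tau> *\<^sub>R u) = 0" "m \<bullet> p = 0"
    using ex_common_normal by blast
  moreover from this have "\<forall>q\<in>L. m \<bullet> q = 0"
    unfolding L_def using great_arc_normal by blast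
  ultimately show ?thesis
    by blast
qed

context antipodal_drawing
begin

lemma add_isolated_vertex:
  assumes "x \<notin> V" "\<And>y. y \<in> V \<Longrightarrow> \<not> adj x y"
  shows "\<exists>P' A' N'. antipodal_drawing (insert x V) adj P' A' N'"
proof -
  obtain u where u: "\<And>n. n \<in> N \<Longrightarrow> n \<bullet> u \<noteq> 0"
    using ex_generic_vector[OF finite_N N_nonzero] by blast
  obtain v :: "real^3" where v: "norm v = 1" "\<And>n. n \<in> N \<Longrightarrow> n \<bullet> v \<noteq> 0"
  proof (cases "N = {}")
    case True
    then show ?thesis
      using that vector_choose_size[of 1] by auto
  next
    case False
    then have "u \<noteq> 0"
      using u by force
    then show ?thesis
      using that[of "sgn u"] u by (auto simp: norm_sgn sgn_div_norm)
  qed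
  obtain m where m: "m \<noteq> 0" "m \<bullet> v = 0"
    using ex_common_normal by blast
  have new: "P y \<noteq> v" "P y \<noteq> - v" "v \<noteq> - P y" if "y \<in> V" for y
    using P_circle[OF that] v(2) by auto
  have vneq: "v \<noteq> - v"
    using v(1) by (rule unit_neq_uminus)
  have nadj: "\<not> adj y x" if "y \<in> insert x V" for y
    using that assms adj_sym adj_irrefl by blast
  have nadj': "\<not> adj x y" if "y \<in> insert x V" for y
    using that assms adj_irrefl by blast
  have "antipodal_drawing (insert x V) adj (P(x := v)) A (insert m N)"
  proof
    fix a b c d q
    assume "a \<in> insert x V" "b \<in> insert x V" "c \<in> insert x V" "d \<in> insert x V"
      "adj a b" "adj c d" "(a, b) \<noteq> (c, d)" "q \<in> A a b" "q \<in> A c d"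
    moreover from this have "a \<noteq> x" "b \<noteq> x" "c \<noteq> x" "d \<noteq> x"
      using nadj nadj' by auto
    ultimately show "a = c \<and> q = (P(x := v)) a \<or> b = d \<and> q = - (P(x := v)) b"
      using A_cross[of a b c d q] by auto
  next
    fix a b c
    assume *: "a \<in> insert x V" "b \<in> insert x V" "c \<in> insert x V" "adj a b" "(P(x := v)) c \<in> A a b"
    then have "a \<noteq> x" "b \<noteq> x"
      using nadj nadj' by auto
    with * have ab: "a \<in> V" "b \<in> V"
      by auto
    show "c = a"
    proof (cases "c = x")
      case True
      then show ?thesis
        using A_circle[OF ab *(4), of v] v *(5) by auto
    next
      case False
      then show ?thesis
        using A_vertex[OF ab _ *(4), of c] * by auto
    qed
  next
    fix a b
    assume *: "a \<in> insert x V" "b \<in> insert x V" "adj a b"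
    then have "a \<noteq> x" "b \<noteq> x"
      using nadj nadj' by auto
    with * have ab: "a \<in> V" "b \<in> V"
      by auto
    show "is_simple_arc (A a b) ((P(x := v)) a) (- (P(x := v)) b)"
      using arc_A[OF ab *(3)] \<open>a \<noteq> x\<close> \<open>b \<noteq> x\<close> by simp
    show "A a b \<subseteq> sphere 0 1" "A b a = uminus ` A a b"
      using A_sphere[OF ab *(3)] A_antipodal[OF ab *(3)] by auto
    show "\<exists>n\<in>insert m N. n \<bullet> q = 0" if "q \<in> A a b" for q
      using A_circle[OF ab *(3) that] by auto
  next
    fix a b
    assume "a \<in> insert x V" "b \<in> insert x V"
    then show "(P(x := v)) a \<noteq> - (P(x := v)) b"
      using P_neq new(2,3) vneq assms(1) by (elim insertE) auto
    show "(P(x := v)) a = (P(x := v)) b \<Longrightarrow> a = b"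
      using P_inj new(1) assms(1) \<open>a \<in> insert x V\<close> \<open>b \<in> insert x V\<close>
      by (elim insertE) (auto split: if_splits)
  next
    fix a
    assume a: "a \<in> insert x V"
    then show "norm ((P(x := v)) a) = 1"
      using norm_P v(1) by auto
    show "\<exists>n\<in>insert m N. n \<bullet> (P(x := v)) a = 0"
      using a P_circle m(2) by auto
  qed (use adj_sym adj_irrefl finite_N N_nonzero m(1) in auto)
  then show ?thesis
    by blast
qed

text \<open>
  The new edge from \<open>x\<close> red to \<open>y\<close> blue is a generic spur at \<open>- P y\<close>, whose free end becomes the new
  red point; the other new edge is its antipode.
\<close>

lemma add_leaf:
  assumes "x \<notin> V" "y \<in> V" "adj x y" and only: "\<And>z. z \<in> V \<Longrightarrow> adj x z \<Longrightarrow> z = y"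
  shows "\<exists>P' A' N'. antipodal_drawing (insert x V) adj P' A' N'"
proof -
  obtain n0 where n0: "n0 \<in> N" "n0 \<bullet> - P y = 0"
    using P_circle[OF assms(2)] by auto
  have "norm (- P y) = 1"
    using norm_P assms(2) by simp
  then obtain r L m where L: "is_simple_arc L r (- P y)" "L \<subseteq> sphere 0 1"
      "\<And>q n. q \<in> L \<Longrightarrow> q \<noteq> - P y \<Longrightarrow> n \<in> N \<Longrightarrow> n \<bullet> q \<noteq> 0"
      "\<And>q. q \<in> L \<Longrightarrow> q \<bullet> - P y > 0"
      "m \<noteq> 0" "\<And>q. q \<in> L \<Longrightarrow> m \<bullet> q = 0"
    using ex_generic_spur[OF finite_N N_nonzero _ n0] by blast
  have r: "r \<in> L" "r \<noteq> - P y" "norm r = 1"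
    using is_simple_arc_ends[OF L(1)] L(2) by auto
  define P' where "P' = P(x := r)"
  define A' where "A' = (\<lambda>a b. if a = x then L else if b = x then uminus ` L else A a b)"
  have "x \<noteq> y"
    using assms(1,2) by blast
  have P': "P' x = r" "\<And>z. z \<in> V \<Longrightarrow> P' z = P z"
    using assms(1) by (auto simp: P'_def)
  have A': "A' x y = L" "A' y x = uminus ` L" "\<And>a b. a \<in> V \<Longrightarrow> b \<in> V \<Longrightarrow> A' a b = A a b"
    using assms(1) \<open>x \<noteq> y\<close> by (auto simp: A'_def)
  have on_L: "q = - P y" if "q \<in> L" "n \<in> N" "n \<bullet> q = 0" for q n
    using L(3) that by blast
  have r_new: "n \<bullet> r \<noteq> 0" if "n \<in> N" for n
    using on_L[OF r(1) that] r(2) by blast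
  have L_antipode: "- q \<notin> L" if "q \<in> L" for q
    using L(4)[OF that] L(4)[of "- q"] by auto
  have minus_L: "q \<in> uminus ` L \<longleftrightarrow> - q \<in> L" for q
    by force
  have edge: "a = x \<and> b = y \<or> a = y \<and> b = x \<or> a \<in> V \<and> b \<in> V"
    if "a \<in> insert x V" "b \<in> insert x V" "adj a b" for a b
    using that only adj_sym adj_irrefl by blast
  have L_old: "d = y \<and> q = - P y"
    if cd: "c \<in> V" "d \<in> V" "adj c d" "q \<in> L" "q \<in> A c d" for c d q
  proof -
    obtain n where "n \<in> N" "n \<bullet> q = 0"
      using A_circle[OF cd(1-3,5)] by blast
    then have "q = - P y"
      using on_L cd(4) by blast
    then show ?thesis
      using A_vertex_blue[OF cd(1,2) assms(2) cd(3)] cd(5) by blast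
  qed
  have new: "P z \<noteq> r" "P z \<noteq> - r" "r \<noteq> - P z" if "z \<in> V" for z
    using P_circle[OF that] r_new by auto
  have rneq: "r \<noteq> - r"
    using r(3) by (rule unit_neq_uminus)
  have L_cross: "d = y \<and> q = - P y"
    if "c \<in> insert x V" "d \<in> insert x V" "adj c d" "(c, d) \<noteq> (x, y)" "q \<in> L" "q \<in> A' c d" for c d q
    using edge[OF that(1-3)]
  proof (elim disjE conjE)
    assume "c = y" "d = x"
    then show ?thesis
      using that A'(2) L_antipode by (auto simp: minus_L)
  next
    assume "c \<in> V" "d \<in> V"
    then show ?thesis
      using L_old[of c d q] that(3,5,6) A'(3) by simp
  qed (use that in simp_all)
  have A'_antipodal: "A' b a = uminus ` A' a b"
    if "a \<in> insert x V" "b \<in> insert x V" "adj a b" for a b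
    using edge[OF that]
  proof (elim disjE conjE)
    assume "a \<in> V" "b \<in> V"
    then show ?thesis
      using A'(3) A_antipodal that(3) by simp
  qed (simp_all add: A' image_image)
  have "antipodal_drawing (insert x V) adj P' A' (insert m N)"
  proof
    fix a b
    assume ab: "a \<in> insert x V" "b \<in> insert x V" "adj a b"
    show "is_simple_arc (A' a b) (P' a) (- P' b)"
      using edge[OF ab]
    proof (elim disjE conjE)
      assume "a = y" "b = x"
      then show ?thesis
        using is_simple_arc_reverse[OF is_simple_arc_uminus[OF L(1)]] A'(2) P' assms(2) by simp
    qed (use L(1) arc_A A' P' assms(2) ab(3) in simp_all)
    show "A' a b \<subseteq> sphere 0 1"
      using edge[OF ab]
    proof (elim disjE conjE)
      assume "a \<in> V" "b \<in> V"
      then show ?thesis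
        using A'(3) A_sphere ab(3) by simp
    qed (use L(2) A' in auto)
    show "A' b a = uminus ` A' a b"
      using A'_antipodal ab by blast
    show "\<exists>n\<in>insert m N. n \<bullet> q = 0" if "q \<in> A' a b" for q
      using edge[OF ab]
    proof (elim disjE conjE)
      assume "a \<in> V" "b \<in> V"
      then show ?thesis
        using A'(3) A_circle ab(3) that by simp
    next
      assume "a = y" "b = x"
      then have "m \<bullet> - q = 0"
        using A'(2) L(6) that minus_L by blast
      then show ?thesis
        by simp
    qed (use L(6) A' that in auto)
    show "c = a" if c: "c \<in> insert x V" "P' c \<in> A' a b" for c
    proof (cases "c = x")
      case True
      then have "P' c = r"
        using P' by simp
      show ?thesis
        using edge[OF ab]
      proof (elim disjE conjE)
        assume "a \<in> V" "b \<in> V"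
        then show ?thesis
          using A'(3) A_circle[OF _ _ ab(3), of r] r_new that \<open>P' c = r\<close> by auto
      next
        assume "a = y" "b = x"
        then show ?thesis
          using A'(2) L_antipode[OF r(1)] minus_L that \<open>P' c = r\<close> by auto
      qed (use True in simp)
    next
      case False
      then have c: "c \<in> V" "P c \<in> A' a b"
        using that P' by auto
      obtain n where n: "n \<in> N" "n \<bullet> P c = 0"
        using P_circle[OF c(1)] by blast
      show ?thesis
        using edge[OF ab]
      proof (elim disjE conjE)
        assume "a \<in> V" "b \<in> V"
        then show ?thesis
          using A'(3) A_vertex ab(3) c by simp
      next
        assume "a = x" "b = y"
        then show ?thesis
          using on_L[of "P c" n] n c A'(1) P_neq[OF c(1) assms(2)] by simp
      next
        assume "a = y" "b = x"
        then have "- P c \<in> L"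
          using A'(2) c minus_L by simp
        then show ?thesis
          using on_L[of "- P c" n] n P_inj[OF c(1) assms(2)] \<open>a = y\<close> by simp
      qed
    qed
    show "a = c \<and> q = P' a \<or> b = d \<and> q = - P' b"
      if cd: "c \<in> insert x V" "d \<in> insert x V" "adj c d" and ne: "(a, b) \<noteq> (c, d)"
        and q: "q \<in> A' a b" "q \<in> A' c d" for c d q
    proof -
      have Py: "P' y = P y"
        using P' assms(2) by simp
      have rev: "- q \<in> A' b a" "- q \<in> A' d c"
        using q A'_antipodal ab cd by auto
      consider "(a, b) = (x, y)" | "(c, d) = (x, y)" | "(b, a) = (x, y)" | "(d, c) = (x, y)"
        | "a \<in> V" "b \<in> V" "c \<in> V" "d \<in> V"
        using edge[OF ab] edge[OF cd] by blast
      then show ?thesis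
      proof cases
        case 1
        then show ?thesis
          using L_cross[OF cd, of q] q ne A'(1) Py by auto
      next
        case 2
        then show ?thesis
          using L_cross[OF ab, of q] q ne A'(1) Py by auto
      next
        case 3
        then show ?thesis
          using L_cross[OF cd(2,1) adj_sym[OF cd(3)], of "- q"] rev ne A'(1) Py by auto
      next
        case 4
        then show ?thesis
          using L_cross[OF ab(2,1) adj_sym[OF ab(3)], of "- q"] rev ne A'(1) Py by auto
      next
        case 5
        then show ?thesis
          using A_cross[OF 5 ab(3) cd(3) ne] q A'(3) P'(2) by simp
      qed
    qed
  next
    fix a b
    assume "a \<in> insert x V" "b \<in> insert x V"
    then show "P' a \<noteq> - P' b"
      using P_neq new(2,3) rneq P' by (elim insertE) auto
    show "P' a = P' b \<Longrightarrow> a = b"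
      using P_inj new(1) P' \<open>a \<in> insert x V\<close> \<open>b \<in> insert x V\<close> by (elim insertE) auto
  next
    fix a
    assume a: "a \<in> insert x V"
    then show "norm (P' a) = 1"
      using norm_P r(3) P' by auto
    show "\<exists>n\<in>insert m N. n \<bullet> P' a = 0"
      using a P_circle L(6) r(1) P' by auto
  qed (use adj_sym adj_irrefl finite_N N_nonzero L(5) in auto)
  then show ?thesis
    by blast
qed

end

section \<open>Diameter graphs of minimum degree two\<close>

text \<open>
  The slack \<open>D\<^sup>2 + \<delta>\<^sup>2 - 2 h (\<alpha> + \<beta>) + 2 \<alpha> \<beta>\<close> is affine in \<open>\<alpha>\<close> and in \<open>\<beta>\<close>, so on the square \<open>[0, D]\<^sup>2\<close> it is a
  weighted mean of its values at the corners.  These values are \<open>E00\<close>, twice \<open>E10\<close>, and \<open>E11\<close> below, and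
  all are positive unless \<open>h = \<delta> = D\<close>.
\<close>

lemma bilinear_corner_equality:
  fixes \<alpha> \<beta> h \<delta> D :: real
  assumes "0 \<le> \<alpha>" "\<alpha> \<le> D" "0 \<le> \<beta>" "\<beta> \<le> D" "h \<le> \<delta>" "0 \<le> \<delta>" "\<delta> \<le> D" "D > 0"
    and le: "D\<^sup>2 + \<delta>\<^sup>2 \<le> 2 * h * (\<alpha> + \<beta>) - 2 * \<alpha> * \<beta>"
  shows "h = D \<and> \<delta> = D"
proof (rule ccontr)
  assume neq: "\<not> ?thesis"
  define E00 E10 E11 where "E00 = D\<^sup>2 + \<delta>\<^sup>2"
    and "E10 = (D - \<delta>)\<^sup>2 + 2 * D * (\<delta> - h)"
    and "E11 = (D - \<delta>) * (3 * D - \<delta>) + 4 * D * (\<delta> - h)"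
  have "E00 > 0"
    using \<open>D > 0\<close> by (simp add: E00_def add_pos_nonneg)
  have "E10 > 0" "E11 > 0"
  proof -
    have nonneg: "0 \<le> 2 * D * (\<delta> - h)" "0 \<le> 4 * D * (\<delta> - h)" "0 \<le> (D - \<delta>) * (3 * D - \<delta>)"
      using assms by auto
    show "E10 > 0"
    proof (cases "\<delta> < D")
      case True
      then show ?thesis
        unfolding E10_def using nonneg by (intro add_pos_nonneg) auto
    next
      case False
      then show ?thesis
        unfolding E10_def using neq assms by (intro add_nonneg_pos) auto
    qed
    show "E11 > 0"
    proof (cases "\<delta> < D")
      case True
      then show ?thesis
        unfolding E11_def using nonneg assms by (intro add_pos_nonneg) auto
    next
      case False
      then show ?thesis
        unfolding E11_def using nonneg neq assms by (intro add_nonneg_pos) auto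
    qed
  qed
  define m where "m = min E00 (min E10 E11)"
  have m: "m > 0" "m \<le> E00" "m \<le> E10" "m \<le> E11"
    using \<open>E00 > 0\<close> \<open>E10 > 0\<close> \<open>E11 > 0\<close> by (auto simp: m_def)
  have "0 < D\<^sup>2 * m"
    using m \<open>D > 0\<close> by simp
  also have "\<dots> = (D - \<alpha>) * (D - \<beta>) * m + \<alpha> * (D - \<beta>) * m + (D - \<alpha>) * \<beta> * m + \<alpha> * \<beta> * m"
    by (simp add: algebra_simps power2_eq_square)
  also have "\<dots> \<le> (D - \<alpha>) * (D - \<beta>) * E00 + \<alpha> * (D - \<beta>) * E10 + (D - \<alpha>) * \<beta> * E10 + \<alpha> * \<beta> * E11"
    using m assms by (intro add_mono mult_left_mono) auto
  also have "\<dots> = D\<^sup>2 * (D\<^sup>2 + \<delta>\<^sup>2 - (2 * h * (\<alpha> + \<beta>) - 2 * \<alpha> * \<beta>))"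
    by (simp add: E00_def E10_def E11_def algebra_simps power2_eq_square)
  also have "\<dots> \<le> 0"
    using le by (intro mult_nonneg_nonpos) auto
  finally show False
    by simp
qed

locale diameter_core =
  fixes V :: "(real^3) set" and D :: real
  assumes finite_V: "finite V"
    and D_pos: "D > 0"
    and dist_le: "x \<in> V \<Longrightarrow> y \<in> V \<Longrightarrow> dist x y \<le> D"
    and deg_ge_2: "x \<in> V \<Longrightarrow> \<exists>y\<in>V. \<exists>z\<in>V. y \<noteq> z \<and> dist x y = D \<and> dist x z = D"
begin

definition nbrs :: "real^3 \<Rightarrow> (real^3) set" where
  "nbrs x = {y \<in> V. dist x y = D}"

definition dirs :: "real^3 \<Rightarrow> (real^3) set" where
  "dirs x = (\<lambda>y. y - x) ` nbrs x"

text \<open>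
  The cone is taken without its apex.  Writing its elements as multiples of points of a
  convex hull turns a linear inequality for the generators into one for the whole cone
  (\<open>hull_inner_ge\<close>).
\<close>

definition in_cone :: "real^3 \<Rightarrow> real^3 \<Rightarrow> bool" where
  "in_cone x q \<longleftrightarrow> (\<exists>k>0. \<exists>u\<in>convex hull (dirs x). q = k *\<^sub>R u)"

definition hub :: "real^3 \<Rightarrow> real^3" where
  "hub x = (\<Sum>y\<in>nbrs x. (1 / card (nbrs x)) *\<^sub>R (y - x))"

definition spoke :: "real^3 \<Rightarrow> real^3 \<Rightarrow> (real^3) set" where
  "spoke x y = great_arc (hub x) (y - x)"

lemma finite_nbrs: "finite (nbrs x)"
  using finite_V by (simp add: nbrs_def)

lemma nbrsD: "y \<in> nbrs x \<Longrightarrow> y \<in> V" "y \<in> nbrs x \<Longrightarrow> norm (y - x) = D"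
  by (auto simp: nbrs_def dist_norm norm_minus_commute)

lemma nbrs_sym: "x \<in> V \<Longrightarrow> y \<in> nbrs x \<Longrightarrow> x \<in> nbrs y"
  by (simp add: nbrs_def dist_commute)

lemma ex_other_nbr:
  assumes "x \<in> V"
  shows "\<exists>z\<in>nbrs x. z \<noteq> y"
  using deg_ge_2[OF assms] by (auto simp: nbrs_def)

lemma law_of_cosines:
  fixes a b :: "real^3"
  shows "2 * (a \<bullet> b) = (norm a)\<^sup>2 + (norm b)\<^sup>2 - (norm (a - b))\<^sup>2"
  by (simp add: power2_norm_eq_inner inner_diff inner_commute)

text \<open>
  The point \<open>z\<close> is at distance at most \<open>D\<close> from \<open>y\<close>, hence not farther from \<open>y\<close> than \<open>x\<close> is; that is,
  \<open>y\<close> lies on the side of \<open>z\<close> of the perpendicular bisector of \<open>xz\<close>.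
\<close>

lemma dir_inner:
  assumes "y \<in> nbrs x" "z \<in> V"
  shows "(norm (z - x))\<^sup>2 / 2 \<le> (z - x) \<bullet> (y - x)"
    and "dist y z = D \<Longrightarrow> (z - x) \<bullet> (y - x) = (norm (z - x))\<^sup>2 / 2"
proof -
  have eq: "2 * ((z - x) \<bullet> (y - x)) = (norm (z - x))\<^sup>2 + D\<^sup>2 - (dist y z)\<^sup>2"
    using law_of_cosines[of "z - x" "y - x"] nbrsD[OF assms(1)]
    by (simp add: dist_norm norm_minus_commute)
  have "dist y z \<le> D"
    using dist_le nbrsD(1) assms by blast
  then have "(dist y z)\<^sup>2 \<le> D\<^sup>2"
    by (simp add: power_mono)
  then show "(norm (z - x))\<^sup>2 / 2 \<le> (z - x) \<bullet> (y - x)"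
    using eq by linarith
  show "(z - x) \<bullet> (y - x) = (norm (z - x))\<^sup>2 / 2" if "dist y z = D"
    using eq that by simp
qed

lemma hull_inner_ge:
  assumes "u \<in> convex hull F" "\<And>a. a \<in> F \<Longrightarrow> k \<le> v \<bullet> a"
  shows "k \<le> v \<bullet> (u :: real^3)"
proof -
  have "convex hull F \<subseteq> {a. k \<le> v \<bullet> a}"
    using assms(2) by (intro hull_minimal) (auto simp: convex_halfspace_ge)
  then show ?thesis
    using assms(1) by blast
qed

lemma hull_dirs_inner:
  assumes "u \<in> convex hull (dirs x)" "z \<in> V"
  shows "(norm (z - x))\<^sup>2 / 2 \<le> (z - x) \<bullet> u"
  using assms(1)
proof (rule hull_inner_ge)
  fix a assume "a \<in> dirs x"
  then show "(norm (z - x))\<^sup>2 / 2 \<le> (z - x) \<bullet> a"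
    using dir_inner(1)[OF _ assms(2)] unfolding dirs_def by blast
qed

lemma hull_dirs_nonzero:
  assumes "u \<in> convex hull (dirs x)" "x \<in> V"
  shows "u \<noteq> 0"
proof -
  obtain z where "z \<in> nbrs x"
    using ex_other_nbr[OF assms(2)] by blast
  then show ?thesis
    using hull_dirs_inner[OF assms(1), of z] nbrsD D_pos by force
qed

lemma hull_dirs_norm:
  assumes "u \<in> convex hull (dirs x)"
  shows "norm u \<le> D"
proof -
  have "convex hull (dirs x) \<subseteq> cball 0 D"
    by (intro hull_minimal) (auto simp: dirs_def nbrsD)
  then show ?thesis
    using assms by auto
qed

text \<open>
  The plane through the origin orthogonal to \<open>z - x\<close> separates the two cones strictly.
\<close>

lemma cones_disjoint:
  assumes "x \<in> V" "z \<in> V" "in_cone x q" "in_cone z q"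
  shows "x = z"
proof (rule ccontr)
  assume "x \<noteq> z"
  obtain k u l v where q: "k > 0" "u \<in> convex hull (dirs x)" "q = k *\<^sub>R u"
      "l > 0" "v \<in> convex hull (dirs z)" "q = l *\<^sub>R v"
    using assms(3,4) unfolding in_cone_def by blast
  have "0 < (norm (z - x))\<^sup>2 / 2" "0 < (norm (x - z))\<^sup>2 / 2"
    using \<open>x \<noteq> z\<close> by simp_all
  then have "0 < (z - x) \<bullet> u" "0 < (x - z) \<bullet> v"
    using hull_dirs_inner[OF q(2) assms(2)] hull_dirs_inner[OF q(5) assms(1)] by linarith+
  then have "0 < (z - x) \<bullet> q" "0 < (x - z) \<bullet> q"
    using q(1,4) by (metis inner_scaleR_right mult_pos_pos q(3), metis inner_scaleR_right mult_pos_pos q(6))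
  then show False
    by (simp add: inner_diff_left)
qed

text \<open>
  For single directions \<open>y - x\<close> and \<open>z - w\<close> this is the inequality \<open>dist y z \<le> D\<close>, multiplied out.
  The result is affine in either direction separately and so extends to the convex hulls, first
  in one argument and then in the other.
\<close>

lemma hull_dirs_opposite:
  assumes "x \<in> V" "w \<in> V" "u \<in> convex hull (dirs x)" "v \<in> convex hull (dirs w)"
  shows "D\<^sup>2 + (norm (w - x))\<^sup>2 \<le> 2 * (u \<bullet> (w - x)) - 2 * (v \<bullet> (w - x)) + 2 * (u \<bullet> v)"
proof -
  define d where "d = w - x"
  have gen: "D\<^sup>2 + (norm d)\<^sup>2 \<le> 2 * (a \<bullet> d) - 2 * (b \<bullet> d) + 2 * (a \<bullet> b)"
    if ab: "a \<in> dirs x" "b \<in> dirs w" for a b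
  proof -
    obtain y z where yz: "y \<in> nbrs x" "a = y - x" "z \<in> nbrs w" "b = z - w"
      using ab unfolding dirs_def by blast
    have "norm (a - b - d) \<le> D"
      using dist_le[of y z] nbrsD(1) yz by (simp add: d_def dist_norm)
    then have "(norm (a - b - d))\<^sup>2 \<le> D\<^sup>2"
      by (simp add: power_mono)
    moreover have "(norm (a - b - d))\<^sup>2 =
        (norm a)\<^sup>2 + (norm b)\<^sup>2 + (norm d)\<^sup>2 - 2 * (a \<bullet> b) - 2 * (a \<bullet> d) + 2 * (b \<bullet> d)"
      by (simp add: power2_norm_eq_inner inner_diff inner_commute algebra_simps)
    ultimately show ?thesis
      using nbrsD(2) yz by simp
  qed
  have left: "D\<^sup>2 + (norm d)\<^sup>2 \<le> 2 * (u \<bullet> d) - 2 * (b \<bullet> d) + 2 * (u \<bullet> b)" if "b \<in> dirs w" for b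
  proof -
    have "D\<^sup>2 + (norm d)\<^sup>2 + 2 * (b \<bullet> d) \<le> (2 *\<^sub>R d + 2 *\<^sub>R b) \<bullet> u"
      using assms(3)
    proof (rule hull_inner_ge)
      fix a assume "a \<in> dirs x"
      from gen[OF this that]
      show "D\<^sup>2 + (norm d)\<^sup>2 + 2 * (b \<bullet> d) \<le> (2 *\<^sub>R d + 2 *\<^sub>R b) \<bullet> a"
        by (simp add: inner_add_left inner_add_right inner_commute)
    qed
    then show ?thesis
      by (simp add: inner_add_left inner_add_right inner_commute)
  qed
  have "D\<^sup>2 + (norm d)\<^sup>2 - 2 * (u \<bullet> d) \<le> (2 *\<^sub>R u - 2 *\<^sub>R d) \<bullet> v"
    using assms(4)
  proof (rule hull_inner_ge)
    fix b assume "b \<in> dirs w"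
    from left[OF this]
    show "D\<^sup>2 + (norm d)\<^sup>2 - 2 * (u \<bullet> d) \<le> (2 *\<^sub>R u - 2 *\<^sub>R d) \<bullet> b"
      by (simp add: inner_diff_left inner_diff_right inner_commute)
  qed
  then show ?thesis
    by (simp add: d_def[symmetric] inner_diff_left inner_diff_right inner_commute)
qed

text \<open>
  If \<open>q\<close> lies in the cone of \<open>x\<close> and \<open>- q\<close> in that of \<open>w\<close>, then \<open>q\<close> is a positive multiple of \<open>u\<close> and of
  \<open>- v\<close> with \<open>u\<close> and \<open>v\<close> in the two hulls, both of norm at most \<open>D\<close>.
  The inequality of \<open>hull_dirs_opposite\<close> then involves only the two norms, the length of \<open>w - x\<close> and
  its component along \<open>q\<close>, and can hold only in the extreme case where this component and the
  length are both \<open>D\<close>.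
\<close>

lemma cones_opposite:
  assumes "x \<in> V" "w \<in> V" "in_cone x q" "in_cone w (- q)"
  shows "w \<in> nbrs x \<and> (\<exists>k>0. q = k *\<^sub>R (w - x))"
proof -
  obtain k u l v where q: "k > 0" "u \<in> convex hull (dirs x)" "q = k *\<^sub>R u"
      "l > 0" "v \<in> convex hull (dirs w)" "- q = l *\<^sub>R v"
    using assms(3,4) unfolding in_cone_def by blast
  have "u \<noteq> 0"
    using hull_dirs_nonzero q(2) assms(1) by blast
  then have "q \<noteq> 0"
    using q by simp
  have polar: "a = norm a *\<^sub>R sgn a" for a :: "real^3"
    by (cases "a = 0") (simp_all add: sgn_div_norm)
  have "sgn u = sgn q"
    using q(1,3) by (simp add: sgn_scaleR)
  then have u: "u = norm u *\<^sub>R sgn q"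
    using polar[of u] by simp
  have "sgn v = sgn (- q)"
    unfolding q(6) using q(4) by (simp add: sgn_scaleR)
  then have v: "v = - (norm v *\<^sub>R sgn q)"
    using polar[of v] by (simp add: sgn_minus)
  define d where "d = w - x"
  have "sgn q \<bullet> d \<le> norm (sgn q) * norm d"
    by (rule norm_cauchy_schwarz)
  then have h: "sgn q \<bullet> d \<le> norm d"
    using \<open>q \<noteq> 0\<close> by (simp add: norm_sgn)
  have "D\<^sup>2 + (norm d)\<^sup>2 \<le> 2 * (u \<bullet> d) - 2 * (v \<bullet> d) + 2 * (u \<bullet> v)"
    using hull_dirs_opposite[OF assms(1,2) q(2,5)] by (simp add: d_def)
  moreover have "u \<bullet> d = norm u * (sgn q \<bullet> d)" "v \<bullet> d = - norm v * (sgn q \<bullet> d)"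
    by (subst u v, simp)+
  moreover have "u \<bullet> v = - norm u * norm v"
  proof -
    have "u \<bullet> v = norm u * (- norm v) * (sgn q \<bullet> sgn q)"
      by (subst u, subst v) simp
    then show ?thesis
      using \<open>q \<noteq> 0\<close> by (simp add: dot_square_norm norm_sgn)
  qed
  ultimately have "D\<^sup>2 + (norm d)\<^sup>2 \<le> 2 * (sgn q \<bullet> d) * (norm u + norm v) - 2 * norm u * norm v"
    by (simp add: algebra_simps)
  then have eq: "sgn q \<bullet> d = D \<and> norm d = D"
    using hull_dirs_norm[OF q(2)] hull_dirs_norm[OF q(5)] h D_pos dist_le[OF assms(1,2)]
    by (intro bilinear_corner_equality[of "norm u" _ "norm v"])
       (auto simp: d_def dist_norm norm_minus_commute)
  then have "sgn q \<bullet> d = norm (sgn q) * norm d"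
    using \<open>q \<noteq> 0\<close> by (simp add: norm_sgn)
  then have "d = D *\<^sub>R sgn q"
    using eq \<open>q \<noteq> 0\<close> unfolding norm_cauchy_schwarz_eq by (simp add: norm_sgn)
  then have "q = (norm q / D) *\<^sub>R d"
    using D_pos \<open>q \<noteq> 0\<close> by (simp add: sgn_div_norm)
  moreover have "norm q / D > 0"
    using D_pos \<open>q \<noteq> 0\<close> by simp
  ultimately show ?thesis
    using eq assms(2) unfolding d_def nbrs_def by (auto simp: dist_norm norm_minus_commute)
qed

text \<open>
  This is where degree at least two of \<open>y\<close> enters.  Let \<open>z \<noteq> x\<close> be another neighbour of \<open>y\<close>.  Among the
  directions at \<open>x\<close>, the inner product with \<open>z - x\<close> is smallest at \<open>y - x\<close>, since \<open>z\<close> is at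
  distance exactly \<open>D\<close> from \<open>y\<close>; the inner product with \<open>y - x\<close> is largest there, and only there,
  because all directions have length \<open>D\<close>.  Scaled to the value \<open>1\<close> at \<open>y - x\<close>, the difference
  of the two functionals is the required one.
\<close>

lemma dir_exposed:
  assumes "x \<in> V" "y \<in> nbrs x"
  shows "\<exists>g. g \<bullet> (y - x) = 0 \<and> (\<forall>y'\<in>nbrs x. y' \<noteq> y \<longrightarrow> 0 < g \<bullet> (y' - x))"
proof -
  obtain z where z: "z \<in> nbrs y" "z \<noteq> x"
    using ex_other_nbr nbrsD(1) assms(2) by blast
  define c where "c = 2 / (norm (z - x))\<^sup>2"
  have "c > 0"
    using z(2) by (simp add: c_def)
  define g where "g = c *\<^sub>R (z - x) - (1 / D\<^sup>2) *\<^sub>R (y - x)"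
  have zV: "z \<in> V" "dist y z = D"
    using z(1) by (auto simp: nbrs_def)
  have "c * ((z - x) \<bullet> (y - x)) = 1"
    using dir_inner(2)[OF assms(2) zV] z(2) by (simp add: c_def)
  moreover have "(y - x) \<bullet> (y - x) = D\<^sup>2"
    using nbrsD(2)[OF assms(2)] by (simp add: dot_square_norm)
  ultimately have "g \<bullet> (y - x) = 0"
    using D_pos by (simp add: g_def inner_diff_left)
  moreover have "0 < g \<bullet> (y' - x)" if "y' \<in> nbrs x" "y' \<noteq> y" for y'
  proof -
    have "c * ((norm (z - x))\<^sup>2 / 2) \<le> c * ((z - x) \<bullet> (y' - x))"
      using dir_inner(1)[OF that(1) zV(1)] \<open>c > 0\<close> by (intro mult_left_mono) auto
    moreover have "c * ((norm (z - x))\<^sup>2 / 2) = 1"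
      using z(2) by (simp add: c_def)
    moreover have "2 * ((y - x) \<bullet> (y' - x)) = D\<^sup>2 + D\<^sup>2 - (norm (y - y'))\<^sup>2"
      using law_of_cosines[of "y - x" "y' - x"] nbrsD(2) assms(2) that(1) by simp
    then have "(y - x) \<bullet> (y' - x) < D\<^sup>2"
      using that(2) by (smt (verit) right_minus_eq zero_less_norm_iff zero_less_power)
    then have "(1 / D\<^sup>2) * ((y - x) \<bullet> (y' - x)) < 1"
      using D_pos by simp
    ultimately show ?thesis
      unfolding g_def inner_diff_left[of "c *\<^sub>R (z - x)"] inner_scaleR_left by linarith
  qed
  ultimately show ?thesis
    by blast
qed

lemma hub_exposed:
  assumes "x \<in> V" "y \<in> nbrs x"
  shows "\<exists>g. g \<bullet> (y - x) = 0 \<and> (\<forall>y'\<in>nbrs x. y' \<noteq> y \<longrightarrow> 0 < g \<bullet> (y' - x)) \<and> 0 < g \<bullet> hub x"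
proof -
  obtain g where g: "g \<bullet> (y - x) = 0" "\<And>y'. y' \<in> nbrs x \<Longrightarrow> y' \<noteq> y \<Longrightarrow> 0 < g \<bullet> (y' - x)"
    using dir_exposed[OF assms] by blast
  obtain z where z: "z \<in> nbrs x" "z \<noteq> y"
    using ex_other_nbr[OF assms(1)] by blast
  have "card (nbrs x) > 0"
    using z(1) finite_nbrs by (auto simp: card_gt_0_iff)
  have "0 < (\<Sum>y'\<in>nbrs x. (1 / card (nbrs x)) * (g \<bullet> (y' - x)))"
  proof (rule sum_pos2[OF finite_nbrs z(1)])
    show "0 < (1 / card (nbrs x)) * (g \<bullet> (z - x))"
      using g(2)[OF z] \<open>card (nbrs x) > 0\<close> by simp
    show "0 \<le> (1 / card (nbrs x)) * (g \<bullet> (y' - x))" if "y' \<in> nbrs x" for y'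
      using g(1) g(2)[OF that] by (cases "y' = y") auto
  qed
  then have "0 < g \<bullet> hub x"
    by (simp add: hub_def inner_sum_right)
  then show ?thesis
    using g by blast
qed

lemma hub_dir_independent:
  assumes "x \<in> V" "y \<in> nbrs x" "s *\<^sub>R hub x + t *\<^sub>R (y - x) = 0"
  shows "s = 0 \<and> t = 0"
proof -
  obtain g where g: "g \<bullet> (y - x) = 0" "0 < g \<bullet> hub x"
    using hub_exposed[OF assms(1,2)] by blast
  have "g \<bullet> (s *\<^sub>R hub x + t *\<^sub>R (y - x)) = 0"
    using assms(3) by simp
  then have "s = 0"
    using g by (simp add: inner_add_right)
  moreover have "y - x \<noteq> 0"
    using nbrsD(2)[OF assms(2)] D_pos by auto
  ultimately show ?thesis
    using assms(3) by simp
qed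

text \<open>
  The functional exposing \<open>y - x\<close> gives \<open>s \<ge> s'\<close>, the one exposing \<open>z - x\<close> gives \<open>s' \<ge> s\<close>, and
  equality forces the remaining coefficients to vanish.
\<close>

lemma spokes_meet_at_hub:
  assumes "x \<in> V" "y \<in> nbrs x" "z \<in> nbrs x" "y \<noteq> z" "t \<ge> 0" "t' \<ge> 0"
    and eq: "s *\<^sub>R hub x + t *\<^sub>R (y - x) = s' *\<^sub>R hub x + t' *\<^sub>R (z - x)"
  shows "t = 0 \<and> t' = 0"
proof -
  obtain g where g: "g \<bullet> (y - x) = 0" "0 < g \<bullet> (z - x)" "0 < g \<bullet> hub x"
    using hub_exposed[OF assms(1,2)] assms(3) assms(4)[symmetric] by blast
  obtain f where f: "f \<bullet> (z - x) = 0" "0 < f \<bullet> (y - x)" "0 < f \<bullet> hub x"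
    using hub_exposed[OF assms(1,3)] assms(2,4) by blast
  have "g \<bullet> (s *\<^sub>R hub x + t *\<^sub>R (y - x)) = g \<bullet> (s' *\<^sub>R hub x + t' *\<^sub>R (z - x))"
    using eq by simp
  then have g_eq: "(s - s') * (g \<bullet> hub x) = t' * (g \<bullet> (z - x))"
    using g(1) by (simp add: inner_add_right algebra_simps)
  have "f \<bullet> (s *\<^sub>R hub x + t *\<^sub>R (y - x)) = f \<bullet> (s' *\<^sub>R hub x + t' *\<^sub>R (z - x))"
    using eq by simp
  then have f_eq: "(s' - s) * (f \<bullet> hub x) = t * (f \<bullet> (y - x))"
    using f(1) by (simp add: inner_add_right algebra_simps)
  have "0 \<le> (s - s') * (g \<bullet> hub x)" "0 \<le> (s' - s) * (f \<bullet> hub x)"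
    unfolding g_eq f_eq using g f assms(5,6) by simp_all
  then have "s = s'"
    using g(3) f(3) by (simp add: zero_le_mult_iff)
  then show ?thesis
    using g_eq f_eq g f by simp
qed

lemma hub_in_hull:
  assumes "x \<in> V"
  shows "hub x \<in> convex hull (dirs x)"
proof -
  obtain z where "z \<in> nbrs x"
    using ex_other_nbr[OF assms] by blast
  then have "card (nbrs x) > 0"
    using finite_nbrs by (auto simp: card_gt_0_iff)
  then show ?thesis
    unfolding hub_def
    by (intro convex_sum finite_nbrs) (auto simp: dirs_def hull_inc)
qed

lemma spoke_in_cone:
  assumes "x \<in> V" "y \<in> nbrs x" "q \<in> spoke x y"
  shows "in_cone x q"
proof -
  obtain s t where st: "s \<ge> 0" "t \<ge> 0" "q = s *\<^sub>R hub x + t *\<^sub>R (y - x)" "norm q = 1"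
    using assms(3) unfolding spoke_def by (rule great_arcE)
  have pos: "s + t > 0"
    using st by (cases "s = 0 \<and> t = 0") auto
  define u where "u = (s / (s + t)) *\<^sub>R hub x + (t / (s + t)) *\<^sub>R (y - x)"
  have "y - x \<in> convex hull (dirs x)"
    using assms(2) by (simp add: dirs_def hull_inc)
  then have "u \<in> convex hull (dirs x)"
    unfolding u_def using hub_in_hull[OF assms(1)] st pos
    by (intro convexD[OF convex_convex_hull]) (auto simp flip: add_divide_distrib)
  moreover have "q = (s + t) *\<^sub>R u"
    using pos st(3) by (simp add: u_def scaleR_add_right)
  ultimately show ?thesis
    using pos unfolding in_cone_def by blast
qed

lemma simple_arc_spoke:
  assumes "x \<in> V" "y \<in> nbrs x"
  shows "is_simple_arc (spoke x y) (sgn (hub x)) (sgn (y - x))"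
  unfolding spoke_def by (intro simple_arc_great_arc hub_dir_independent[OF assms])

lemma spoke_norm: "q \<in> spoke x y \<Longrightarrow> norm q = 1"
  by (simp add: spoke_def great_arc_def)

lemma spoke_inter_spoke:
  assumes "x \<in> V" "z \<in> V" "y \<in> nbrs x" "w \<in> nbrs z" "(x, y) \<noteq> (z, w)"
    and q: "q \<in> spoke x y" "q \<in> spoke z w"
  shows "x = z \<and> q = sgn (hub x)"
proof -
  have "x = z"
    using cones_disjoint spoke_in_cone assms by blast
  then have w: "w \<in> nbrs x" "y \<noteq> w" "q \<in> spoke x w"
    using assms by auto
  obtain s t where st: "s \<ge> 0" "t \<ge> 0" "q = s *\<^sub>R hub x + t *\<^sub>R (y - x)" "norm q = 1"
    using q(1) unfolding spoke_def by (rule great_arcE)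
  obtain s' t' where st': "s' \<ge> 0" "t' \<ge> 0" "q = s' *\<^sub>R hub x + t' *\<^sub>R (w - x)"
    using w(3) unfolding spoke_def by (rule great_arcE)
  have "t = 0"
    using spokes_meet_at_hub[OF assms(1,3) w(1,2) st(2) st'(2)] st(3) st'(3) by metis
  then have "q = s *\<^sub>R hub x" "s \<noteq> 0"
    using st by auto
  then have "sgn q = sgn (hub x)"
    using st(1) by (simp add: sgn_scaleR)
  then show ?thesis
    using \<open>x = z\<close> st(4) by (simp add: sgn_div_norm)
qed

lemma spoke_toward:
  assumes "x \<in> V" "y \<in> nbrs x" "w \<in> nbrs x" "q \<in> spoke x y" "q = k *\<^sub>R (w - x)" "k > 0"
  shows "w = y"
proof (rule ccontr)
  assume "w \<noteq> y"
  obtain s t where st: "s \<ge> 0" "t \<ge> 0" "q = s *\<^sub>R hub x + t *\<^sub>R (y - x)"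
    using assms(4) unfolding spoke_def by (rule great_arcE)
  have "k = 0"
    using spokes_meet_at_hub[of x y w t k s 0] assms st \<open>w \<noteq> y\<close> by simp
  then show False
    using assms(6) by simp
qed

lemma spoke_inter_opposite:
  assumes "x \<in> V" "w \<in> V" "y \<in> nbrs x" "z \<in> nbrs w" and q: "q \<in> spoke x y" "- q \<in> spoke w z"
  shows "w = y \<and> z = x \<and> q = sgn (y - x)"
proof -
  obtain k where k: "w \<in> nbrs x" "k > 0" "q = k *\<^sub>R (w - x)"
    using cones_opposite spoke_in_cone assms by blast
  then have "w = y"
    using spoke_toward assms by blast
  moreover have "- q = k *\<^sub>R (x - w)"
    unfolding k(3) by (simp add: algebra_simps)
  then have "x = z"
    using spoke_toward[OF assms(2,4) nbrs_sym[OF assms(1) k(1)] q(2)] k(2) by blast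
  moreover have "sgn q = sgn (w - x)"
    using k(2,3) by (simp add: sgn_scaleR)
  then have "q = sgn (w - x)"
    using spoke_norm[OF q(1)] by (simp add: sgn_div_norm)
  ultimately show ?thesis
    by simp
qed

lemma hub_point_not_dir:
  assumes "x \<in> V" "w \<in> nbrs x" "k > 0"
  shows "sgn (hub x) \<noteq> k *\<^sub>R (w - x)"
proof
  assume "sgn (hub x) = k *\<^sub>R (w - x)"
  then have "inverse (norm (hub x)) *\<^sub>R hub x + (- k) *\<^sub>R (w - x) = 0"
    by (simp add: sgn_div_norm)
  then show False
    using hub_dir_independent[OF assms(1,2), of "inverse (norm (hub x))" "- k"] assms(3) by simp
qed

lemma hub_point_in_spoke:
  assumes "x \<in> V" "y \<in> nbrs x"
  shows "sgn (hub x) \<in> spoke x y"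
  using is_simple_arc_ends(1)[OF simple_arc_spoke[OF assms]] .

lemma hub_point_in_cone:
  assumes "x \<in> V"
  shows "in_cone x (sgn (hub x))"
  using ex_other_nbr[OF assms] hub_point_in_spoke spoke_in_cone assms by blast

lemma hub_point_not_opposite:
  assumes "x \<in> V" "w \<in> V"
  shows "\<not> in_cone w (- sgn (hub x))"
  using cones_opposite[OF assms hub_point_in_cone[OF assms(1)]] hub_point_not_dir[OF assms(1)]
  by blast

definition edge_arc :: "real^3 \<Rightarrow> real^3 \<Rightarrow> (real^3) set" where
  "edge_arc x y = spoke x y \<union> uminus ` spoke y x"

lemma mem_edge_arc: "q \<in> edge_arc x y \<longleftrightarrow> q \<in> spoke x y \<or> - q \<in> spoke y x"
  by (force simp: edge_arc_def)

lemma simple_arc_edge_arc: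
  assumes "x \<in> V" "y \<in> nbrs x"
  shows "is_simple_arc (edge_arc x y) (sgn (hub x)) (- sgn (hub y))"
  unfolding edge_arc_def
proof (rule is_simple_arc_join[OF simple_arc_spoke[OF assms]])
  have y: "y \<in> V" "x \<in> nbrs y"
    using nbrsD(1)[OF assms(2)] nbrs_sym[OF assms] by auto
  have "- sgn (x - y) = sgn (y - x)"
    by (metis minus_diff_eq sgn_minus)
  then show "is_simple_arc (uminus ` spoke y x) (sgn (y - x)) (- sgn (hub y))"
    using is_simple_arc_reverse[OF is_simple_arc_uminus[OF simple_arc_spoke[OF y]]] by simp
  show "spoke x y \<inter> uminus ` spoke y x \<subseteq> {sgn (y - x)}"
    using spoke_inter_opposite[OF assms(1) y(1) assms(2) y(2)] by force
qed

theorem ex_antipodal_drawing: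
  "\<exists>P A N. antipodal_drawing V (\<lambda>x y. dist x y = D) P A N"
proof -
  obtain n :: "real^3 \<Rightarrow> real^3 \<Rightarrow> real^3"
    where n: "\<And>a b. n a b \<noteq> 0" "\<And>a b. n a b \<bullet> a = 0" "\<And>a b. n a b \<bullet> b = 0"
    using ex_common_normal by metis
  define N where "N = (\<lambda>(x, y). n (hub x) (y - x)) ` (V \<times> V)"
  have spoke_circle: "\<exists>n\<in>N. n \<bullet> q = 0" if "x \<in> V" "y \<in> V" "q \<in> spoke x y" for x y q
    using great_arc_normal[OF that(3)[unfolded spoke_def] n(2,3)] that by (force simp: N_def)
  have nb: "y \<in> nbrs x" "x \<in> nbrs y" if "x \<in> V" "y \<in> V" "dist x y = D" for x y
    using that by (auto simp: nbrs_def dist_commute)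
  have "antipodal_drawing V (\<lambda>x y. dist x y = D) (\<lambda>x. sgn (hub x)) edge_arc N"
  proof
    fix x assume x: "x \<in> V"
    show "norm (sgn (hub x)) = 1"
      using hull_dirs_nonzero[OF hub_in_hull[OF x] x] by (simp add: norm_sgn)
    obtain y where "y \<in> nbrs x"
      using ex_other_nbr[OF x] by blast
    then show "\<exists>n\<in>N. n \<bullet> sgn (hub x) = 0"
      using spoke_circle[OF x] hub_point_in_spoke[OF x] nbrsD(1) by blast
  next
    fix x y assume xy: "x \<in> V" "y \<in> V"
    show "sgn (hub x) = sgn (hub y) \<Longrightarrow> x = y"
      using cones_disjoint[OF xy] hub_point_in_cone xy by metis
    show "sgn (hub x) \<noteq> - sgn (hub y)"
      using hub_point_not_opposite[OF xy(2,1)] hub_point_in_cone[OF xy(1)] by metis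
  next
    fix x y assume xy: "x \<in> V" "y \<in> V" "dist x y = D"
    show "is_simple_arc (edge_arc x y) (sgn (hub x)) (- sgn (hub y))"
      using simple_arc_edge_arc[OF xy(1)] nb xy by blast
    show "edge_arc x y \<subseteq> sphere 0 1"
      using spoke_norm by (auto simp: edge_arc_def)
    show "edge_arc y x = uminus ` edge_arc x y"
      by (auto simp: edge_arc_def image_Un image_image)
    show "\<exists>n\<in>N. n \<bullet> q = 0" if "q \<in> edge_arc x y" for q
      using that spoke_circle[OF xy(1,2), of q] spoke_circle[OF xy(2,1), of "- q"]
      by (auto simp: mem_edge_arc)
    show "z = x" if z: "z \<in> V" "sgn (hub z) \<in> edge_arc x y" for z
    proof -
      have "- sgn (hub z) \<notin> spoke y x"
        using hub_point_not_opposite[OF z(1) xy(2)] spoke_in_cone[OF xy(2) nb(2)[OF xy]] by blast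
      then have "in_cone x (sgn (hub z))"
        using z(2) spoke_in_cone[OF xy(1) nb(1)[OF xy]] by (auto simp: mem_edge_arc)
      then show ?thesis
        using cones_disjoint[OF z(1) xy(1) hub_point_in_cone[OF z(1)]] by blast
    qed
    show "x = z \<and> q = sgn (hub x) \<or> y = w \<and> q = - sgn (hub y)"
      if zw: "z \<in> V" "w \<in> V" "dist z w = D" and ne: "(x, y) \<noteq> (z, w)"
        and q: "q \<in> edge_arc x y" "q \<in> edge_arc z w" for z w q
    proof -
      note nbs = nb[OF xy] nb[OF zw]
      consider "q \<in> spoke x y" "q \<in> spoke z w" | "q \<in> spoke x y" "- q \<in> spoke w z"
        | "- q \<in> spoke y x" "q \<in> spoke z w" | "- q \<in> spoke y x" "- q \<in> spoke w z"
        using q by (auto simp: mem_edge_arc)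
      then show ?thesis
      proof cases
        case 1
        then show ?thesis
          using spoke_inter_spoke[OF xy(1) zw(1) nbs(1,3) ne] by blast
      next
        case 2
        then show ?thesis
          using spoke_inter_opposite[OF xy(1) zw(2) nbs(1,4)] ne by blast
      next
        case 3
        then show ?thesis
          using spoke_inter_opposite[OF zw(1) xy(2) nbs(3,2)] ne by blast
      next
        case 4
        then have "y = w \<and> - q = sgn (hub y)"
          using spoke_inter_spoke[OF xy(2) zw(2) nbs(2,4)] ne by blast
        then show ?thesis
          by (metis minus_minus)
      qed
    qed
  next
    show "finite N"
      using finite_V by (simp add: N_def)
    show "0 \<notin> N"
      using n(1) by (force simp: N_def)
  next
    show "dist y x = D" if "dist x y = D" for x y :: "real^3"
      using that by (simp add: dist_commute)
    show "dist x x \<noteq> D" for x :: "real^3"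
      using D_pos by simp
  qed
  then show ?thesis
    by blast
qed

end

section \<open>Arbitrary diameter graphs\<close>

text \<open>
  Induction on \<open>V\<close>: a vertex with at most one neighbour is removed and put back; if there is none,
  the construction for minimum degree two applies, which includes the empty set.
\<close>

theorem ex_antipodal_drawing_distance_graph:
  fixes V :: "(real^3) set"
  assumes "finite V" "D > 0" "\<And>x y. x \<in> V \<Longrightarrow> y \<in> V \<Longrightarrow> dist x y \<le> D"
  shows "\<exists>P A N. antipodal_drawing V (\<lambda>x y. dist x y = D) P A N"
  using assms
proof (induction V rule: finite_psubset_induct)
  case (psubset V)
  show ?case
  proof (cases "\<exists>x\<in>V. \<exists>y. \<forall>z\<in>V. dist x z = D \<longrightarrow> z = y")
    case True
    then obtain x y where x: "x \<in> V" "\<And>z. z \<in> V \<Longrightarrow> dist x z = D \<Longrightarrow> z = y"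
      by blast
    define W where "W = V - {x}"
    have W: "insert x W = V" "x \<notin> W" "W \<subset> V"
      using x(1) by (auto simp: W_def)
    have "\<exists>P A N. antipodal_drawing W (\<lambda>x y. dist x y = D) P A N"
      using psubset.prems W(3) by (intro psubset.IH) auto
    then obtain P A N where W_drawing: "antipodal_drawing W (\<lambda>x y. dist x y = D) P A N"
      by blast
    show ?thesis
    proof (cases "y \<in> W \<and> dist x y = D")
      case True
      then show ?thesis
        using antipodal_drawing.add_leaf[OF W_drawing W(2), of y] x(2) W(1) by blast
    next
      case False
      then show ?thesis
        using antipodal_drawing.add_isolated_vertex[OF W_drawing W(2)] x(2) W(1) by blast
    qed
  next
    case False
    interpret diameter_core V D
    proof
      fix x assume "x \<in> V"
      then obtain y where "y \<in> V" "dist x y = D"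
        using False by blast
      moreover then obtain z where "z \<in> V" "dist x z = D" "z \<noteq> y"
        using False \<open>x \<in> V\<close> by blast
      ultimately show "\<exists>y\<in>V. \<exists>z\<in>V. y \<noteq> z \<and> dist x y = D \<and> dist x z = D"
        by blast
    qed (use psubset in auto)
    show ?thesis
      by (rule ex_antipodal_drawing)
  qed
qed

lemma (in antipodal_drawing) double_cover_drawing:
  assumes E: "\<And>x y. {x, y} \<in> E \<longleftrightarrow> x \<in> V \<and> y \<in> V \<and> adj x y"
  shows "\<exists>pt ar.
    sphere_drawing (double_cover_verts V) (double_cover_edges E) pt ar \<and>
    centrally_symmetric V E pt ar \<and>
    no_crossings (double_cover_verts V) (double_cover_edges E) pt ar"
proof -
  define pt where "pt = (\<lambda>(x, c). case c of Red \<Rightarrow> P x | Blue \<Rightarrow> - P x)"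
  \<comment> \<open>an edge of the double covering has one red and one blue endpoint, which the descriptions recover\<close>
  define ar where "ar = (\<lambda>e. A (THE x. (x, Red) \<in> e) (THE y. (y, Blue) \<in> e))"
  have pt: "pt (x, Red) = P x" "pt (x, Blue) = - P x" for x
    by (simp_all add: pt_def)
  have ar: "ar {(x, Red), (y, Blue)} = A x y" for x y
    by (simp add: ar_def)
  have edgeE: "\<exists>x y. e = {(x, Red), (y, Blue)} \<and> x \<in> V \<and> y \<in> V \<and> adj x y"
    if "e \<in> double_cover_edges E" for e
    using that E unfolding double_cover_edges_def by blast
  have "sphere_drawing (double_cover_verts V) (double_cover_edges E) pt ar"
    unfolding sphere_drawing_def
  proof (intro conjI allI impI)
    show "inj_on pt (double_cover_verts V)"
    proof (rule inj_onI, clarify)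
      fix x c y d
      assume *: "(x, c) \<in> double_cover_verts V" "(y, d) \<in> double_cover_verts V" "pt (x, c) = pt (y, d)"
      then have "x \<in> V" "y \<in> V"
        by (auto simp: double_cover_verts_def)
      with * show "x = y \<and> c = d"
        using P_inj[of x y] P_neq[of x y] P_neq[of y x] by (cases c; cases d) (auto simp: pt)
    qed
    show "pt ` double_cover_verts V \<subseteq> sphere 0 1"
      using norm_P by (auto simp: pt_def double_cover_verts_def split: colour.splits)
  next
    fix u v
    assume "{u, v} \<in> double_cover_edges E"
    from edgeE[OF this] obtain x y
      where xy: "{u, v} = {(x, Red), (y, Blue)}" "x \<in> V" "y \<in> V" "adj x y"
      by blast
    show "ar {u, v} \<subseteq> sphere 0 1"
      unfolding xy(1) ar using A_sphere xy by blast
    have "u = (x, Red) \<and> v = (y, Blue) \<or> u = (y, Blue) \<and> v = (x, Red)"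
      using xy(1) by (auto simp: doubleton_eq_iff)
    then show "is_simple_arc (ar {u, v}) (pt u) (pt v)"
      unfolding xy(1) ar using arc_A[OF xy(2-4)] is_simple_arc_reverse pt by auto
  qed
  moreover have "centrally_symmetric V E pt ar"
    unfolding centrally_symmetric_def
  proof (intro conjI ballI allI impI)
    fix x y assume "{x, y} \<in> E"
    then show "ar {(x, Blue), (y, Red)} = uminus ` ar {(x, Red), (y, Blue)}"
      using A_antipodal E by (simp add: ar insert_commute[of "(x, Blue)"])
  qed (simp add: pt)
  moreover have "no_crossings (double_cover_verts V) (double_cover_edges E) pt ar"
    unfolding no_crossings_def
  proof (intro conjI ballI impI subsetI)
    fix e f q
    assume ef: "e \<in> double_cover_edges E" "f \<in> double_cover_edges E" "e \<noteq> f" "q \<in> ar e \<inter> ar f"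
    obtain x y where xy: "e = {(x, Red), (y, Blue)}" "x \<in> V" "y \<in> V" "adj x y"
      using edgeE[OF ef(1)] by blast
    obtain z w where zw: "f = {(z, Red), (w, Blue)}" "z \<in> V" "w \<in> V" "adj z w"
      using edgeE[OF ef(2)] by blast
    have "(x, y) \<noteq> (z, w)"
      using ef(3) xy(1) zw(1) by blast
    moreover have "q \<in> A x y" "q \<in> A z w"
      using ef(4) by (auto simp: xy(1) zw(1) ar)
    ultimately have "x = z \<and> q = P x \<or> y = w \<and> q = - P y"
      using A_cross[OF xy(2,3) zw(2,3) xy(4) zw(4)] by blast
    then show "q \<in> pt ` e \<inter> pt ` f"
      by (auto simp: xy(1) zw(1) pt)
  next
    fix e q
    assume e: "e \<in> double_cover_edges E" "q \<in> ar e \<inter> pt ` double_cover_verts V"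
    obtain x y where xy: "e = {(x, Red), (y, Blue)}" "x \<in> V" "y \<in> V" "adj x y"
      using edgeE[OF e(1)] by blast
    obtain z c where z: "z \<in> V" "q = pt (z, c)"
      using e(2) by (auto simp: double_cover_verts_def)
    have "q \<in> A x y"
      using e(2) by (simp add: xy(1) ar)
    then show "q \<in> pt ` e"
      using A_vertex[OF xy(2,3) z(1) xy(4)] A_vertex_blue[OF xy(2,3) z(1) xy(4)] z(2)
      by (cases c) (auto simp: xy(1) pt)
  qed
  ultimately show ?thesis
    by blast
qed

theorem theorem2:
  fixes S :: "(real^3) set"
  assumes "finite S"
  shows "\<exists>pt ar.
    sphere_drawing (double_cover_verts S) (double_cover_edges (diameter_edges S)) pt ar \<and>
    centrally_symmetric S (diameter_edges S) pt ar \<and>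
    no_crossings (double_cover_verts S) (double_cover_edges (diameter_edges S)) pt ar"
proof -
  have le: "dist x y \<le> diameter S" if "x \<in> S" "y \<in> S" for x y
    using diameter_bounded_bound[OF finite_imp_bounded[OF assms] that] .
  \<comment> \<open>if the diameter is \<open>0\<close>, any positive distance also yields the graph without edges\<close>
  define D where "D = (if diameter S > 0 then diameter S else 1)"
  have "D > 0"
    by (simp add: D_def)
  have adj: "dist x y = D \<longleftrightarrow> x \<noteq> y \<and> dist x y = diameter S" if "x \<in> S" "y \<in> S" for x y
  proof (cases "x = y")
    case True
    then show ?thesis
      using \<open>D > 0\<close> by simp
  next
    case False
    then have "0 < diameter S"
      using le[OF that] zero_less_dist_iff[of x y] by linarith
    then show ?thesis
      using False by (simp add: D_def)
  qed
  have "dist x y \<le> D" if "x \<in> S" "y \<in> S" for x y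
    using le[OF that] by (auto simp: D_def)
  then obtain P A N where "antipodal_drawing S (\<lambda>x y. dist x y = D) P A N"
    using ex_antipodal_drawing_distance_graph[OF assms \<open>D > 0\<close>] by blast
  then interpret antipodal_drawing S "\<lambda>x y. dist x y = D" P A N .
  have "{x, y} \<in> diameter_edges S \<longleftrightarrow> x \<in> S \<and> y \<in> S \<and> dist x y = D" for x y
    using adj[of x y] by (auto simp: diameter_edges_def doubleton_eq_iff dist_commute)
  then show ?thesis
    by (rule double_cover_drawing)
qed

end
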